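(* Let $k\ge 2$ be an integer, let $a_1,\dots,a_k$ be positive integers, and let $b_1,\dots,b_k$ be integers. Assume that $a_ib_j\ne a_jb_i$ for every $1\le i<j\le k$. Then for any positive constant $C$, the set of positive integers $n$ for which \[ \frac{\phi(a_1n+b_1)}{\phi(a_2n+b_2)} > C, \quad \frac{\phi(a_2n+b_2)}{\phi(a_3n+b_3)} > C, \quad\dots,\quad \frac{\phi(a_{k-1}n+b_{k-1})}{\phi(a_kn+b_k)} > C \] all hold has positive lower density. In particular, the set of positive integers $n$ for which \[ \phi(a_1n+b_1) > \phi(a_2n+b_2) > \dots > \phi(a_kn+b_k) \] has positive lower density.
   Context: $\phi$ denotes the Euler phi-function on positive integers. The lower density of a set $S$ of positive integers is $\liminf_{x\to\infty} \frac1x\#\{n\in S: n\le x\}$. Only those $n$ for which every argument $a_in+b_i$ is positive are considered; this excludes only finitely many $n$ and does not affect lower density. *)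

theory Defs
  imports "HOL-Analysis.Analysis" "HOL-Number_Theory.Number_Theory"
begin

(* Intended for sets of positive integers.  The value is taken in ereal because Liminf
   needs a complete lattice; x ranges over the reals. *)
definition lower_density :: "nat set \<Rightarrow> ereal" where
  "lower_density S =
     Liminf at_top (\<lambda>x::real. ereal (real (card {n \<in> S. real n \<le> x}) / x))"

end

theory Submission
  imports Defs "HOL-Real_Asymp.Real_Asymp"
begin

text \<open>
  Write \<open>m\<^sub>i = a\<^sub>i n + b\<^sub>i\<close>, so that \<open>\<phi>(m\<^sub>i)\<close> is \<open>m\<^sub>i\<close> times the product of \<open>1 - 1/p\<close> over the
  primes \<open>p\<close> dividing \<open>m\<^sub>i\<close>. The idea is to prescribe the size of these products by congruences on
  \<open>n\<close>, and to check that the remaining primes rarely matter.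

  Fix \<open>y\<close> at least \<open>8 k\<close> and at least every \<open>\<bar>a\<^sub>i\<bar>\<close>, \<open>\<bar>b\<^sub>i\<bar>\<close> and \<open>\<bar>a\<^sub>i b\<^sub>j - a\<^sub>j b\<^sub>i\<bar>\<close>. As the product of
  \<open>1 - 1/p\<close> over all primes diverges to 0, there are pairwise disjoint finite sets \<open>P\<^sub>i\<close> of primes
  exceeding \<open>y\<close> whose products \<open>w\<^sub>i\<close> decrease as fast as desired, \<open>w\<^sub>i\<^sub>+\<^sub>1 < \<delta> w\<^sub>i\<close>
  (\<open>exists_prime_blocks\<close>). By the Chinese remainder theorem there is a residue class
  \<open>n = r + R t\<close>, with \<open>R\<close> the product of all the primes chosen, on which every prime of \<open>P\<^sub>i\<close>
  divides \<open>m\<^sub>i\<close>; hence \<open>\<phi>(m\<^sub>i) \<le> w\<^sub>i m\<^sub>i\<close> there (\<open>totient_le_prod\<close>).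

  For the matching lower bound, a prime \<open>p > y\<close> dividing both \<open>m\<^sub>i\<close> and \<open>m\<^sub>j\<close> with \<open>i \<noteq> j\<close> would divide the
  nonzero number \<open>a\<^sub>i b\<^sub>j - a\<^sub>j b\<^sub>i\<close>, which is too small. So the primes dividing \<open>m\<^sub>i\<close> are those of
  \<open>P\<^sub>i\<close>, some primes up to \<open>y\<close>, and some primes above \<open>y\<close> not dividing \<open>a\<^sub>i R\<close>. A first moment
  estimate and Markov's inequality show that for at most \<open>4 T / y\<close> of the \<open>t < T\<close> the
  reciprocals of the last kind of primes add up to more than \<open>1/2\<close>
  (\<open>eventually_few_large_prime_sums\<close>). For all other \<open>t\<close> these primes contribute a factor at least
  \<open>1/2\<close>, so \<open>\<phi>(m\<^sub>i) \<ge> W w\<^sub>i m\<^sub>i / 2\<close>, where \<open>W\<close> is the product of \<open>1 - 1/p\<close> over the primes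
  \<open>p \<le> y\<close> (\<open>totient_ge_prod\<close>). As \<open>y \<ge> 8 k\<close>, at most half of all \<open>t\<close> are lost to the \<open>k\<close> forms
  together, and for the remaining large \<open>t\<close> the ratios exceed \<open>C\<close> because
  \<open>\<delta> = W / (8 y C)\<close> depends on \<open>y\<close> and \<open>C\<close> only. The second claim is the case \<open>C = 1\<close>.
\<close>


section \<open>The product of 1 - 1/p over primes\<close>

text \<open>Mertens' product: the product of \<open>1 - 1/p\<close> over the primes \<open>p \<le> N\<close>.\<close>
definition mertens_prod :: "nat \<Rightarrow> real" where
  "mertens_prod N = (\<Prod>p | prime p \<and> p \<le> N. 1 - 1 / real p)"

lemma prime_factor_bounds:
  assumes "prime (p::nat)"
  shows "0 < 1 - 1 / real p" "1 - 1 / real p \<le> 1" "0 \<le> 1 - 1 / real p"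
proof -
  have "real p > 1" using prime_gt_1_nat[OF assms] by simp
  then show "0 < 1 - 1 / real p" "1 - 1 / real p \<le> 1" "0 \<le> 1 - 1 / real p"
    by (auto simp: field_simps)
qed

lemma finite_primes_le: "finite {p::nat. prime p \<and> p \<le> N}"
  by (rule finite_subset[of _ "{..N}"]) auto

lemma mertens_prod_pos: "mertens_prod N > 0"
  unfolding mertens_prod_def using prime_factor_bounds by (intro prod_pos) blast

lemma mertens_prod_le_1: "mertens_prod N \<le> 1"
  unfolding mertens_prod_def using prime_factor_bounds by (intro prod_le_1) blast

text \<open>
  A finite form of Euler's product inequality, for the integers up to \<open>N\<close> all of whose prime
  factors lie in \<open>S\<close>. When a prime \<open>q\<close> joins \<open>S\<close>, the new integers are \<open>q\<close> times integers of the
  enlarged set, so the enlarged sum \<open>T\<close> and the old sum \<open>B\<close> satisfy \<open>T \<le> B + T / q\<close>.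
\<close>
lemma sum_inverse_smooth_le:
  assumes "finite S" "\<And>p. p \<in> S \<Longrightarrow> prime p"
  shows "(\<Sum>m | m \<in> {1..N} \<and> prime_factors m \<subseteq> S. 1 / real m)
           * (\<Prod>p\<in>S. 1 - 1 / real p) \<le> 1"
  using assms
proof (induction S)
  case empty
  have "{m. m \<in> {1..N} \<and> prime_factors m \<subseteq> {}} \<subseteq> {1}"
  proof
    fix m assume m: "m \<in> {m. m \<in> {1..N} \<and> prime_factors m \<subseteq> {}}"
    then have "prime_factorization m = {#}" by auto
    then have "is_unit m" using m by (subst (asm) prime_factorization_empty_iff) auto
    then show "m \<in> {1}" by auto
  qed
  then have "(\<Sum>m | m \<in> {1..N} \<and> prime_factors m \<subseteq> {}. 1 / real m) \<le> (\<Sum>m\<in>{1::nat}. 1 / real m)"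
    by (intro sum_mono2) auto
  then show ?case by simp
next
  case (insert q S)
  let ?V = "\<lambda>S. {m. m \<in> {1..N} \<and> prime_factors m \<subseteq> S}"
  let ?T = "?V (insert q S)"
  have q: "prime q" using insert by auto
  have fin: "finite (?V U)" for U by (rule finite_subset[of _ "{1..N}"]) auto
  have sub: "?T \<subseteq> ?V S \<union> (\<lambda>m. q * m) ` ?T"
  proof
    fix m assume m: "m \<in> ?T"
    show "m \<in> ?V S \<union> (\<lambda>m. q * m) ` ?T"
    proof (cases "q dvd m")
      case True
      then obtain l where l: "m = q * l" by auto
      have "l > 0" using m l by (cases "l = 0") auto
      moreover have "l \<le> m" using l prime_gt_0_nat[OF q] by simp
      moreover have "prime_factors l \<subseteq> prime_factors m"
        using l m by (intro dvd_prime_factors) auto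
      ultimately have "l \<in> ?T" using m by auto
      then show ?thesis using l by auto
    next
      case False
      then have "q \<notin> prime_factors m" by auto
      then show ?thesis using m by auto
    qed
  qed
  have "(\<Sum>m\<in>?T. 1 / real m) \<le> (\<Sum>m\<in>?V S \<union> (\<lambda>m. q * m) ` ?T. 1 / real m)"
    using fin[of S] fin[of "insert q S"] by (intro sum_mono2[OF _ sub]) auto
  also have "\<dots> \<le> (\<Sum>m\<in>?V S. 1 / real m) + (\<Sum>m\<in>(\<lambda>m. q * m) ` ?T. 1 / real m)"
    using fin[of S] fin[of "insert q S"]
    by (subst sum_Un) (auto intro!: sum_nonneg)
  also have "(\<Sum>m\<in>(\<lambda>m. q * m) ` ?T. 1 / real m) = (\<Sum>m\<in>?T. 1 / real m) / real q"
    using prime_gt_0_nat[OF q]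
    by (subst sum.reindex) (auto simp: inj_on_def sum_divide_distrib mult.commute)
  finally have "(\<Sum>m\<in>?T. 1 / real m) * (1 - 1 / real q) \<le> (\<Sum>m\<in>?V S. 1 / real m)"
    by (simp add: algebra_simps)
  then have "((\<Sum>m\<in>?T. 1 / real m) * (1 - 1 / real q)) * (\<Prod>p\<in>S. 1 - 1 / real p)
      \<le> (\<Sum>m\<in>?V S. 1 / real m) * (\<Prod>p\<in>S. 1 - 1 / real p)"
    using insert prime_factor_bounds by (intro mult_right_mono prod_nonneg) blast+
  also have "\<dots> \<le> 1" using insert by auto
  finally show ?case using insert by (simp add: mult.assoc)
qed

lemma harm_times_mertens_prod_le_1: "harm N * mertens_prod N \<le> 1"
proof -
  let ?S = "{p::nat. prime p \<and> p \<le> N}"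
  have "{m. m \<in> {1..N} \<and> prime_factors m \<subseteq> ?S} = {1..N}"
    by (auto dest!: dvd_imp_le simp: in_prime_factors_iff)
  then show ?thesis
    using sum_inverse_smooth_le[OF finite_primes_le, of N N]
    by (simp add: mertens_prod_def harm_def field_simps)
qed

lemma mertens_prod_arbitrarily_small:
  assumes "\<epsilon> > 0"
  shows "\<exists>M\<ge>N. mertens_prod M < \<epsilon>"
proof -
  have "eventually (\<lambda>M. harm M > 1 / \<epsilon>) sequentially"
    using harm_at_top by (simp add: filterlim_at_top_dense)
  then have "eventually (\<lambda>M. harm M > 1 / \<epsilon> \<and> M \<ge> N) sequentially"
    using eventually_ge_at_top by (rule eventually_conj)
  then obtain M where M: "harm M > 1 / \<epsilon>" "M \<ge> N"
    by (auto simp: eventually_sequentially)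
  have "mertens_prod M / \<epsilon> < harm M * mertens_prod M"
    using mult_strict_right_mono[OF M(1) mertens_prod_pos[of M]] by simp
  also have "\<dots> \<le> 1" by (rule harm_times_mertens_prod_le_1)
  finally show ?thesis using M assms by (auto simp: field_simps)
qed

lemma mertens_prod_split:
  assumes "N \<le> M"
  shows "mertens_prod M = mertens_prod N * (\<Prod>p | prime p \<and> N < p \<and> p \<le> M. 1 - 1 / real p)"
proof -
  have "{p::nat. prime p \<and> p \<le> M} = {p. prime p \<and> p \<le> N} \<union> {p. prime p \<and> N < p \<and> p \<le> M}"
    using assms by auto
  then show ?thesis unfolding mertens_prod_def
    by (simp add: prod.union_disjoint finite_primes_le finite_subset[OF _ finite_primes_le[of M]] disjoint_iff subset_eq)
qed

text \<open>
  The blocks are the primes in \<open>(N\<^sub>i, N\<^sub>i\<^sub>+\<^sub>1]\<close> for a sequence \<open>N\<close> that starts at or above \<open>y\<close> and grows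
  fast enough.
\<close>
lemma exists_prime_blocks:
  assumes "\<delta> > 0"
  shows "\<exists>P::nat \<Rightarrow> nat set. (\<forall>i. finite (P i) \<and> (\<forall>p\<in>P i. prime p \<and> p > y))
      \<and> (\<forall>i j. i \<noteq> j \<longrightarrow> P i \<inter> P j = {})
      \<and> (\<forall>i. (\<Prod>p\<in>P (Suc i). 1 - 1 / real p) < \<delta> * (\<Prod>p\<in>P i. 1 - 1 / real p))"
proof -
  \<comment> \<open>The square lets each choice depend on the current \<open>N\<^sub>i\<close> alone: one factor
      accounts for the primes up to \<open>N\<^sub>i\<close>, the other is at most the product over the block
      ending at \<open>N\<^sub>i\<close>.\<close>
  have "\<exists>N. \<forall>i. N i \<ge> y \<and> (N i \<le> N (Suc i) \<and> mertens_prod (N (Suc i)) < \<delta> * mertens_prod (N i) ^ 2)"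
  proof (rule dependent_nat_choice)
    fix x :: nat and i :: nat
    assume "x \<ge> y"
    moreover obtain M where "M \<ge> x" "mertens_prod M < \<delta> * mertens_prod x ^ 2"
      using mertens_prod_arbitrarily_small[of "\<delta> * mertens_prod x ^ 2" x] assms mertens_prod_pos[of x]
      by auto
    ultimately show "\<exists>M\<ge>y. x \<le> M \<and> mertens_prod M < \<delta> * (mertens_prod x)\<^sup>2"
      by (intro exI[of _ M]) auto
  qed auto
  then obtain N where N: "\<And>i. N i \<ge> y" "\<And>i. N i \<le> N (Suc i)"
    "\<And>i. mertens_prod (N (Suc i)) < \<delta> * mertens_prod (N i) ^ 2" by blast
  define P where "P i = {p. prime p \<and> N i < p \<and> p \<le> N (Suc i)}" for i
  have mono: "i \<le> j \<Longrightarrow> N i \<le> N j" for i j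
    using N(2) by (rule lift_Suc_mono_le)
  have prodP: "mertens_prod (N (Suc i)) = mertens_prod (N i) * (\<Prod>p\<in>P i. 1 - 1 / real p)" for i
    unfolding P_def by (rule mertens_prod_split[OF N(2)])
  have disj: "P i \<inter> P j = {}" if "i < j" for i j
    using mono[of "Suc i" j] that unfolding P_def by force
  show ?thesis
  proof (intro exI[of _ P] conjI allI impI)
    fix i show "finite (P i)" unfolding P_def
      by (rule finite_subset[OF _ finite_primes_le[of "N (Suc i)"]]) auto
    show "\<forall>p\<in>P i. prime p \<and> p > y" unfolding P_def using N(1)[of i] by auto
    have pos: "(\<Prod>p\<in>P i. 1 - 1 / real p) \<ge> 0" 
      using prime_factor_bounds by (intro prod_nonneg) (auto simp: P_def)
    have "mertens_prod (N (Suc i)) * (\<Prod>p\<in>P (Suc i). 1 - 1 / real p) 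
            < mertens_prod (N (Suc i)) * (\<delta> * mertens_prod (N (Suc i)))"
      using N(3)[of "Suc i"] unfolding prodP[of "Suc i"] by (simp add: power2_eq_square mult_ac)
    then have "(\<Prod>p\<in>P (Suc i). 1 - 1 / real p) < \<delta> * mertens_prod (N (Suc i))"
      using mertens_prod_pos[of "N (Suc i)"] by (simp only: mult_less_cancel_left_pos)
    also have "\<dots> \<le> \<delta> * (\<Prod>p\<in>P i. 1 - 1 / real p)"
      using mertens_prod_le_1[of "N i"] assms pos unfolding prodP 
      by (intro mult_left_mono) (auto intro: mult_left_le_one_le mertens_prod_pos less_imp_le)
    finally show "(\<Prod>p\<in>P (Suc i). 1 - 1 / real p) < \<delta> * (\<Prod>p\<in>P i. 1 - 1 / real p)" .
  next
    fix i j :: nat assume "i \<noteq> j"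
    then show "P i \<inter> P j = {}" using disj[of i j] disj[of j i] by (cases "i < j") auto
  qed
qed

section \<open>Large prime factors of a linear form\<close>

lemma card_linear_divisible_le:
  fixes \<alpha> \<beta> :: int
  assumes p: "prime p" "\<not> int p dvd \<alpha>"
  shows "real (card {t. t < T \<and> int p dvd \<alpha> * int t + \<beta>}) \<le> real T / real p + 1"
proof -
  let ?A = "{t. t < T \<and> int p dvd \<alpha> * int t + \<beta>}"
  have pos: "p > 0" using p prime_gt_0_nat by blast
  \<comment> \<open>The solutions lie in one residue class modulo \<open>p\<close>, so each block of \<open>p\<close> consecutive
      integers contains at most one.\<close>
  have "inj_on (\<lambda>t. t div p) ?A"
  proof (rule inj_onI)
    fix s t assume st: "s \<in> ?A" "t \<in> ?A" "s div p = t div p"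
    have "int p dvd (\<alpha> * int s + \<beta>) - (\<alpha> * int t + \<beta>)"
      using st by (intro dvd_diff) auto
    then have "int p dvd \<alpha> * (int s - int t)" by (simp add: algebra_simps)
    then have "int p dvd int s - int t"
      using p by (simp add: prime_dvd_mult_iff)
    then have "s mod p = t mod p"
      by (metis mod_eq_dvd_iff of_nat_eq_iff zmod_int)
    then show "s = t" using st(3) by (metis div_mult_mod_eq)
  qed
  moreover have "(\<lambda>t. t div p) ` ?A \<subseteq> {..T div p}"
    by (auto intro: div_le_mono)
  ultimately have "card ?A \<le> card {..T div p}"
    by (intro card_inj_on_le) auto
  then have "real (card ?A) \<le> real (T div p) + 1" by simp
  also have "real (T div p) \<le> real T / real p" by (rule of_nat_div_le_of_nat)
  finally show ?thesis by simp
qed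

lemma sum_inverse_squares_tail_le:
  assumes "y > 0"
  shows "(\<Sum>d\<in>{y<..M}. 1 / real d ^ 2) \<le> 1 / real y"
proof (cases "y \<le> M")
  case True
  then have "(\<Sum>d\<in>{y<..M}. 1 / real d ^ 2) \<le> 1 / real y - 1 / real M"
  proof (induction M rule: dec_induct)
    case (step M)
    have M: "real M > 0" using step assms by simp
    have "{y<..Suc M} = insert (Suc M) {y<..M}" using step by auto
    then have "(\<Sum>d\<in>{y<..Suc M}. 1 / real d ^ 2)
        = 1 / real (Suc M) ^ 2 + (\<Sum>d\<in>{y<..M}. 1 / real d ^ 2)" by simp
    also have "1 / real (Suc M) ^ 2 \<le> 1 / (real M * real (Suc M))"
      using M by (intro divide_left_mono) (auto simp: power2_eq_square)
    also have "1 / (real M * real (Suc M)) = 1 / real M - 1 / real (Suc M)"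
      using M by (simp add: field_simps)
    finally show ?case using step by simp
  qed simp
  then show ?thesis by (smt (verit) divide_nonneg_nonneg of_nat_0_le_iff)
qed (use assms in simp)

text \<open>
  The sum of \<open>1/p\<close> over the primes \<open>p > y\<close> that divide \<open>m\<close> but not \<open>\<alpha>\<close>. It is used for values
  \<open>m > 0\<close> of a linear form with leading coefficient \<open>\<alpha>\<close>; for \<open>m \<le> 0\<close> it is 0, since
  \<open>nat m = 0\<close> has no prime factors.
\<close>
definition large_prime_sum :: "nat \<Rightarrow> int \<Rightarrow> int \<Rightarrow> real" where
  "large_prime_sum y \<alpha> m =
     (\<Sum>p | p \<in> prime_factors (nat m) \<and> p > y \<and> \<not> int p dvd \<alpha>. 1 / real p)"

lemma large_prime_sum_nonneg: "large_prime_sum y \<alpha> m \<ge> 0"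
  unfolding large_prime_sum_def by (intro sum_nonneg) auto

lemma harm_le_ln: "n > 0 \<Longrightarrow> harm n \<le> 1 + ln (real n)"
proof -
  assume n: "n > 0"
  have "harm (Suc (n - 1)) - ln (real (Suc (n - 1))) \<le> harm (Suc 0) - ln (real (Suc 0))"
    using decseq_harm_diff_ln unfolding decseq_def by blast
  then show ?thesis using n by (simp add: harm_def)
qed

text \<open>
  First moment. After interchanging the summations, the prime \<open>p\<close> contributes at most
  \<open>(T / p + 1) / p\<close>; the terms \<open>T / p\<^sup>2\<close> give \<open>T / y\<close> and the terms \<open>1 / p\<close> a harmonic number, which
  is only logarithmic in \<open>T\<close>.
\<close>
lemma sum_large_prime_sum_le:
  fixes \<alpha> \<beta> :: int
  assumes \<alpha>: "\<alpha> > 0" and y: "y > 0"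
  shows "(\<Sum>t | t < T \<and> \<alpha> * int t + \<beta> > 0. large_prime_sum y \<alpha> (\<alpha> * int t + \<beta>))
     \<le> real T / real y + harm (nat (\<alpha> * int T + \<bar>\<beta>\<bar>))"
proof -
  define M where "M = nat (\<alpha> * int T + \<bar>\<beta>\<bar>)"
  let ?A = "{t. t < T \<and> \<alpha> * int t + \<beta> > 0}"
  let ?Q = "{p. prime p \<and> y < p \<and> p \<le> M \<and> \<not> int p dvd \<alpha>}"
  have finQ: "finite ?Q" by (rule finite_subset[of _ "{..M}"]) auto
  have "(\<Sum>t\<in>?A. large_prime_sum y \<alpha> (\<alpha> * int t + \<beta>))
      = (\<Sum>t\<in>?A. \<Sum>p | p \<in> ?Q \<and> int p dvd \<alpha> * int t + \<beta>. 1 / real p)"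
  proof (rule sum.cong[OF refl])
    fix t assume t: "t \<in> ?A"
    then have dvd: "p dvd nat (\<alpha> * int t + \<beta>) \<longleftrightarrow> int p dvd \<alpha> * int t + \<beta>" for p
      using dvd_nat_abs_iff[of p "\<alpha> * int t + \<beta>"] by simp
    have "{p \<in> prime_factors (nat (\<alpha> * int t + \<beta>)). y < p \<and> \<not> int p dvd \<alpha>}
        = {p \<in> ?Q. int p dvd \<alpha> * int t + \<beta>}"
    proof (intro equalityI subsetI)
      fix p assume p: "p \<in> {p \<in> prime_factors (nat (\<alpha> * int t + \<beta>)). y < p \<and> \<not> int p dvd \<alpha>}"
      then have d: "int p dvd \<alpha> * int t + \<beta>" using dvd by blast
      then have "int p \<le> \<alpha> * int t + \<beta>" using t by (auto intro: zdvd_imp_le)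
      also have "\<dots> \<le> \<alpha> * int T + \<bar>\<beta>\<bar>" using t \<alpha> by (intro add_mono mult_left_mono) auto
      finally have "p \<le> M" unfolding M_def by simp
      then show "p \<in> {p \<in> ?Q. int p dvd \<alpha> * int t + \<beta>}" using p d by auto
    next
      fix p assume p: "p \<in> {p \<in> ?Q. int p dvd \<alpha> * int t + \<beta>}"
      then have "p dvd nat (\<alpha> * int t + \<beta>)" using dvd by blast
      then show "p \<in> {p \<in> prime_factors (nat (\<alpha> * int t + \<beta>)). y < p \<and> \<not> int p dvd \<alpha>}"
        using p t by (auto simp: in_prime_factors_iff)
    qed
    then show "large_prime_sum y \<alpha> (\<alpha> * int t + \<beta>)
        = (\<Sum>p | p \<in> ?Q \<and> int p dvd \<alpha> * int t + \<beta>. 1 / real p)"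
      unfolding large_prime_sum_def by simp
  qed
  also have "\<dots> = (\<Sum>p\<in>?Q. \<Sum>t | t \<in> ?A \<and> int p dvd \<alpha> * int t + \<beta>. 1 / real p)"
    using finQ by (intro sum.swap_restrict) auto
  also have "\<dots> \<le> (\<Sum>p\<in>?Q. real T * (1 / real p ^ 2) + 1 / real p)"
  proof (rule sum_mono)
    fix p assume p: "p \<in> ?Q"
    have "(\<Sum>t | t \<in> ?A \<and> int p dvd \<alpha> * int t + \<beta>. 1 / real p)
        = real (card {t. t \<in> ?A \<and> int p dvd \<alpha> * int t + \<beta>}) / real p" by simp
    also have "\<dots> \<le> real (card {t. t < T \<and> int p dvd \<alpha> * int t + \<beta>}) / real p"
      by (intro divide_right_mono of_nat_mono card_mono) auto
    also have "\<dots> \<le> (real T / real p + 1) / real p"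
      using p by (intro divide_right_mono card_linear_divisible_le) auto
    also have "\<dots> = real T * (1 / real p ^ 2) + 1 / real p"
      by (simp add: add_divide_distrib power2_eq_square)
    finally show "(\<Sum>t | t \<in> ?A \<and> int p dvd \<alpha> * int t + \<beta>. 1 / real p)
      \<le> real T * (1 / real p ^ 2) + 1 / real p" .
  qed
  also have "\<dots> = real T * (\<Sum>p\<in>?Q. 1 / real p ^ 2) + (\<Sum>p\<in>?Q. 1 / real p)"
    by (simp add: sum.distrib sum_distrib_left)
  also have "\<dots> \<le> real T * (\<Sum>d\<in>{y<..M}. 1 / real d ^ 2) + (\<Sum>d\<in>{1..M}. 1 / real d)"
    using y by (intro add_mono mult_left_mono sum_mono2) auto
  also have "\<dots> \<le> real T * (1 / real y) + harm M"
    using sum_inverse_squares_tail_le[OF y, of M]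
    by (intro add_mono mult_left_mono) (auto simp: harm_def inverse_eq_divide)
  finally show ?thesis unfolding M_def by simp
qed

lemma eventually_few_large_prime_sums:
  fixes \<alpha> \<beta> :: int
  assumes \<alpha>: "\<alpha> > 0" and y: "y > 0"
  shows "eventually (\<lambda>T. real (card {t. t < T \<and> \<alpha> * int t + \<beta> > 0 \<and>
           large_prime_sum y \<alpha> (\<alpha> * int t + \<beta>) > 1/2}) \<le> 4 * real T / real y) sequentially"
proof -
  define A B :: real where "A = real_of_int \<alpha>" and "B = real_of_int \<bar>\<beta>\<bar>"
  have "A > 0" "B \<ge> 0" "real y > 0" using \<alpha> y by (auto simp: A_def B_def)
  then have "eventually (\<lambda>T. 1 + ln (A * real T + B) \<le> real T / real y) sequentially"
    by real_asymp
  then show ?thesis using eventually_gt_at_top[of 0]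
  proof eventually_elim
    case (elim T)
    let ?A = "{t. t < T \<and> \<alpha> * int t + \<beta> > 0}"
    let ?h = "\<lambda>t. large_prime_sum y \<alpha> (\<alpha> * int t + \<beta>)"
    have pos: "\<alpha> * int T + \<bar>\<beta>\<bar> > 0" using \<alpha> elim by (intro add_pos_nonneg) auto
    \<comment> \<open>Markov's inequality: each \<open>t\<close> counted contributes more than \<open>1/2\<close> to the first moment.\<close>
    have "real (card {t \<in> ?A. ?h t > 1/2}) / 2 = (\<Sum>t | t \<in> ?A \<and> ?h t > 1/2. 1/2)" by simp
    also have "\<dots> \<le> (\<Sum>t | t \<in> ?A \<and> ?h t > 1/2. ?h t)"
      by (intro sum_mono) auto
    also have "\<dots> \<le> (\<Sum>t\<in>?A. ?h t)"
      by (intro sum_mono2) (auto intro: large_prime_sum_nonneg)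
    also have "\<dots> \<le> real T / real y + harm (nat (\<alpha> * int T + \<bar>\<beta>\<bar>))"
      by (rule sum_large_prime_sum_le[OF \<alpha> y])
    also have "harm (nat (\<alpha> * int T + \<bar>\<beta>\<bar>)) \<le> 1 + ln (real (nat (\<alpha> * int T + \<bar>\<beta>\<bar>)))"
      using pos by (intro harm_le_ln) auto
    also have "real (nat (\<alpha> * int T + \<bar>\<beta>\<bar>)) = A * real T + B"
      using pos by (simp add: A_def B_def)
    also have "1 + ln (A * real T + B) \<le> real T / real y" by (rule elim)
    finally show ?case by (simp add: conj_assoc)
  qed
qed

section \<open>Lower density\<close>

lemma lower_density_pos_if_progression:
  fixes R r :: nat and c :: real
  assumes R: "R > 0" and c: "c > 0"
  assumes ev: "eventually (\<lambda>T. c * real T \<le> real (card {t. t < T \<and> r + R * t \<in> S})) sequentially"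
  shows "lower_density S > 0"
proof -
  \<comment> \<open>Subtracting \<open>r\<close> is more than enough to make \<open>r + R t \<le> x\<close> for all \<open>t < T x\<close>, as \<open>r \<le> R r\<close>.\<close>
  define T where "T x = nat \<lfloor>x / real R\<rfloor> - r" for x :: real
  have "filterlim T sequentially at_top"
    unfolding T_def filterlim_at_top
  proof
    fix Z
    have "eventually (\<lambda>x::real. x / real R \<ge> real (Z + r)) at_top"
      using R by real_asymp
    then show "eventually (\<lambda>x::real. Z \<le> nat \<lfloor>x / real R\<rfloor> - r) at_top"
      by eventually_elim linarith
  qed
  then have 1: "eventually (\<lambda>x. c * real (T x) \<le> real (card {t. t < T x \<and> r + R * t \<in> S})) at_top"
    by (rule eventually_compose_filterlim[OF ev])
  have 2: "eventually (\<lambda>x::real. x / real R - 1 - real r \<ge> x / (2 * real R)) at_top"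
    using R by real_asymp
  have "eventually (\<lambda>x. ereal (c / (2 * real R)) \<le> ereal (real (card {n \<in> S. real n \<le> x}) / x)) at_top"
    using 1 2 eventually_gt_at_top[of 0]
  proof eventually_elim
    case (elim x)
    have "inj_on (\<lambda>t. r + R * t) {t. t < T x \<and> r + R * t \<in> S}"
      using R by (auto simp: inj_on_def)
    moreover have "(\<lambda>t. r + R * t) ` {t. t < T x \<and> r + R * t \<in> S} \<subseteq> {n \<in> S. real n \<le> x}"
    proof safe
      fix t assume t: "t < T x"
      then have "real (t + r) \<le> real_of_int \<lfloor>x / real R\<rfloor>" unfolding T_def by linarith
      also have "\<dots> \<le> x / real R" by simp
      finally have "real R * real (t + r) \<le> x" using R by (simp add: field_simps)
      moreover have "r + R * t \<le> R * (t + r)" using R by (simp add: algebra_simps)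
      then have "real (r + R * t) \<le> real R * real (t + r)" 
        by (metis of_nat_le_iff of_nat_mult)
      ultimately show "real (r + R * t) \<le> x" by simp
    qed
    moreover have "finite {n \<in> S. real n \<le> x}"
      by (rule finite_subset[of _ "{..nat \<lfloor>x\<rfloor>}"]) (auto simp: le_nat_floor)
    ultimately have "card {t. t < T x \<and> r + R * t \<in> S} \<le> card {n \<in> S. real n \<le> x}"
      by (intro card_inj_on_le)
    then have "c * real (T x) \<le> real (card {n \<in> S. real n \<le> x})" using elim(1) by linarith
    moreover have "x / (2 * real R) \<le> real (T x)"
      using elim(2) unfolding T_def by linarith
    then have "c * (x / (2 * real R)) \<le> c * real (T x)" using c by (intro mult_left_mono) auto
    ultimately have "c / (2 * real R) * x \<le> real (card {n \<in> S. real n \<le> x})"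
      by (simp add: field_simps)
    then show ?case using elim(3) by (simp add: pos_le_divide_eq)
  qed
  then have "ereal (c / (2 * real R)) \<le> lower_density S"
    unfolding lower_density_def by (rule Liminf_bounded)
  moreover have "ereal (c / (2 * real R)) > 0" using c R by simp
  ultimately show ?thesis by (rule less_le_trans[rotated])
qed

lemma lower_density_mono:
  assumes "S \<subseteq> T"
  shows "lower_density S \<le> lower_density T"
  unfolding lower_density_def
proof (rule Liminf_mono)
  show "eventually (\<lambda>x. ereal (real (card {n \<in> S. real n \<le> x}) / x)
          \<le> ereal (real (card {n \<in> T. real n \<le> x}) / x)) at_top"
    using eventually_gt_at_top[of 0]
  proof eventually_elim
    case (elim x)
    have "finite {n \<in> T. real n \<le> x}"
      by (rule finite_subset[of _ "{..nat \<lfloor>x\<rfloor>}"]) (auto simp: le_nat_floor)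
    then have "card {n \<in> S. real n \<le> x} \<le> card {n \<in> T. real n \<le> x}"
      using assms by (intro card_mono) auto
    then show ?case using elim by (simp add: divide_right_mono)
  qed
qed

section \<open>Bounds for the totient function\<close>

lemma prod_primes_antimono:
  assumes "finite B" "A \<subseteq> B" "\<And>p. p \<in> B \<Longrightarrow> prime p"
  shows "(\<Prod>p\<in>B. 1 - 1 / real p) \<le> (\<Prod>p\<in>A. 1 - 1 / real p)"
proof -
  have "(\<Prod>p\<in>B. 1 - 1 / real p) = (\<Prod>p\<in>B - A. 1 - 1 / real p) * (\<Prod>p\<in>A. 1 - 1 / real p)"
    using assms by (intro prod.subset_diff)
  also have "\<dots> \<le> 1 * (\<Prod>p\<in>A. 1 - 1 / real p)"
    using assms prime_factor_bounds by (intro mult_right_mono prod_le_1 prod_nonneg) blast+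
  finally show ?thesis by simp
qed

lemma totient_le_prod:
  assumes "P \<subseteq> prime_factors m"
  shows "real (totient m) \<le> real m * (\<Prod>p\<in>P. 1 - 1 / real p)"
proof -
  have "(\<Prod>p\<in>prime_factors m. 1 - 1 / real p) \<le> (\<Prod>p\<in>P. 1 - 1 / real p)"
    using assms by (intro prod_primes_antimono) auto
  then show ?thesis by (simp add: totient_formula2 mult_left_mono)
qed

text \<open>
  The prime factors of \<open>m\<close> are at most \<open>y\<close>, or in \<open>P\<close>, or counted by \<open>large_prime_sum\<close>; the last
  ones cost at most a factor \<open>1/2\<close> by Weierstrass' product inequality.
\<close>
lemma totient_ge_prod:
  fixes \<alpha> m :: int
  assumes fin: "finite P" and P: "\<And>p. p \<in> P \<Longrightarrow> prime p \<and> p > y"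
    and sub: "\<And>p. p \<in> prime_factors (nat m) \<Longrightarrow> p > y \<Longrightarrow> int p dvd \<alpha> \<Longrightarrow> p \<in> P"
    and h: "large_prime_sum y \<alpha> m \<le> 1 / 2"
  shows "real (nat m) * (mertens_prod y * (\<Prod>p\<in>P. 1 - 1 / real p) / 2) \<le> real (totient (nat m))"
proof -
  let ?f = "\<lambda>p::nat. 1 - 1 / real p"
  let ?F = "prime_factors (nat m)"
  let ?H = "{p \<in> ?F. y < p \<and> \<not> int p dvd \<alpha>}"
  let ?L = "{p::nat. prime p \<and> p \<le> y}"
  have eq: "mertens_prod y * prod ?f P = prod ?f (?L \<union> P)"
    unfolding mertens_prod_def using fin P
    by (subst prod.union_disjoint) (auto simp: finite_primes_le dest!: P)
  have "1 / 2 \<le> prod ?f ?H"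
    using Weierstrass_prod_ineq[of ?H "\<lambda>p. 1 / real p"] h unfolding large_prime_sum_def
    by (force simp: prime_ge_1_nat divide_le_eq_1)
  moreover have nn: "mertens_prod y * prod ?f P \<ge> 0"
    using mertens_prod_pos[of y] P prime_factor_bounds(3)
    by (intro mult_nonneg_nonneg prod_nonneg) auto
  ultimately have "mertens_prod y * prod ?f P / 2 \<le> mertens_prod y * prod ?f P * prod ?f ?H"
    using mult_left_mono[of "1/2" "prod ?f ?H" "mertens_prod y * prod ?f P"] by simp
  also have "\<dots> = prod ?f (?L \<union> P) * prod ?f ?H" by (simp only: eq)
  also have "prod ?f (?L \<union> P) * prod ?f ?H \<le> prod ?f ?F"
  proof -
    have "prod ?f (?L \<union> P) \<le> prod ?f (?F - ?H)"
    proof (rule prod_primes_antimono)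
      show "?F - ?H \<subseteq> ?L \<union> P"
      proof
        fix p assume p: "p \<in> ?F - ?H"
        then show "p \<in> ?L \<union> P" using sub[of p] by (cases "p \<le> y") auto
      qed
    qed (use P fin finite_primes_le in auto)
    then have "prod ?f (?L \<union> P) * prod ?f ?H \<le> prod ?f (?F - ?H) * prod ?f ?H"
      using prime_factor_bounds by (intro mult_right_mono prod_nonneg) auto
    also have "\<dots> = prod ?f ?F"
      by (subst prod.subset_diff[of ?H ?F]) auto
    finally show ?thesis .
  qed
  finally show ?thesis unfolding totient_formula2 by (rule mult_left_mono) simp
qed

section \<open>Ratios of totients of linear forms\<close>

lemma exists_simultaneous_root_mod_primes:
  fixes \<alpha> \<beta> :: "nat \<Rightarrow> int"
  assumes "finite U" and U: "\<And>p. p \<in> U \<Longrightarrow> prime p \<and> \<not> int p dvd \<alpha> p"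
  shows "\<exists>r::nat. \<forall>p\<in>U. int p dvd \<alpha> p * int r + \<beta> p"
proof -
  have "\<exists>u::nat. int p dvd \<alpha> p * int u + \<beta> p" if p: "p \<in> U" for p
  proof -
    have pos: "int p > 0" using U[OF p] prime_gt_0_nat by simp
    have "coprime (\<alpha> p) (int p)"
      using U[OF p] by (metis coprime_commute prime_imp_coprime prime_nat_int_transfer)
    then obtain x where x: "[\<alpha> p * x = 1] (mod int p)"
      using cong_solve_coprime_int by blast
    define u where "u = nat ((- \<beta> p * x) mod int p)"
    have "[int u = - \<beta> p * x] (mod int p)" using pos by (simp add: u_def cong_def)
    then have "[\<alpha> p * int u + \<beta> p = \<alpha> p * (- \<beta> p * x) + \<beta> p] (mod int p)"
      by (intro cong_add cong_mult) auto
    also have "\<alpha> p * (- \<beta> p * x) + \<beta> p = - \<beta> p * (\<alpha> p * x) + \<beta> p" by simp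
    also have "[\<dots> = - \<beta> p * 1 + \<beta> p] (mod int p)" using x by (intro cong_add cong_mult) auto
    finally show ?thesis by (auto simp: cong_0_iff)
  qed
  then obtain u :: "nat \<Rightarrow> nat" where u: "\<And>p. p \<in> U \<Longrightarrow> int p dvd \<alpha> p * int (u p) + \<beta> p"
    by metis
  have "\<exists>r. \<forall>p\<in>U. [r = u p] (mod p)"
    using assms by (intro chinese_remainder_nat) (auto intro: primes_coprime)
  then obtain r where r: "\<And>p. p \<in> U \<Longrightarrow> [r = u p] (mod p)" by blast
  have "int p dvd \<alpha> p * int r + \<beta> p" if p: "p \<in> U" for p
  proof -
    have "[int r = int (u p)] (mod int p)" using r[OF p] by (simp add: cong_int_iff)
    then have "[\<alpha> p * int r + \<beta> p = \<alpha> p * int (u p) + \<beta> p] (mod int p)"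
      by (intro cong_add cong_mult) auto
    then show ?thesis using u[OF p] by (simp add: cong_dvd_iff)
  qed
  then show ?thesis by blast
qed

lemma exists_uniform_bound:
  fixes a b :: "nat \<Rightarrow> int"
  assumes "finite I"
  shows "\<exists>y::nat. y \<ge> K \<and> (\<forall>i\<in>I. \<bar>a i\<bar> \<le> int y \<and> \<bar>b i\<bar> \<le> int y \<and>
           (\<forall>j\<in>I. \<bar>a i * b j - a j * b i\<bar> \<le> int y))"
proof -
  let ?X = "(\<lambda>i. \<bar>a i\<bar>) ` I \<union> (\<lambda>i. \<bar>b i\<bar>) ` I \<union> (\<lambda>(i,j). \<bar>a i * b j - a j * b i\<bar>) ` (I \<times> I)"
  have fin: "finite (insert (int K) ?X)" using assms by auto
  define B where "B = Max (insert (int K) ?X)"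
  have B: "x \<le> B" if "x \<in> insert (int K) ?X" for x
    unfolding B_def by (rule Max_ge[OF fin that])
  have "\<bar>a i * b j - a j * b i\<bar> \<le> B" if "i \<in> I" "j \<in> I" for i j
    using that by (intro B) force
  then show ?thesis
    using B by (intro exI[of _ "nat B"]) force
qed

text \<open>
  The required residue class and the count of good \<open>t\<close> in it. The constant \<open>\<delta>\<close> is such that
  \<open>C m\<^sub>i\<^sub>+\<^sub>1 \<delta> w\<^sub>i \<le> m\<^sub>i W w\<^sub>i / 2\<close>, given that \<open>m\<^sub>i\<^sub>+\<^sub>1 \<le> 2 y n\<close> and \<open>n \<le> 2 m\<^sub>i\<close> for large \<open>n\<close>.
\<close>
lemma totient_ratios_lower_density_pos:
  fixes k :: nat and a b :: "nat \<Rightarrow> int" and C :: real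
  assumes k: "k > 0" and C: "C > 0"
    and a: "\<And>i. i \<in> {1..k} \<Longrightarrow> a i > 0"
    and ab: "\<And>i j. i \<in> {1..k} \<Longrightarrow> j \<in> {1..k} \<Longrightarrow> i \<noteq> j \<Longrightarrow> a i * b j \<noteq> a j * b i"
  shows "lower_density {n::nat. n > 0 \<and> (\<forall>i\<in>{1..k}. a i * int n + b i > 0) \<and>
              (\<forall>i\<in>{1..<k}.
                 real (totient (nat (a i * int n + b i)))
                   / real (totient (nat (a (i + 1) * int n + b (i + 1)))) > C)} > 0"
    (is "lower_density ?S > 0")
proof -
  let ?I = "{1..k}"
  obtain y where y: "y \<ge> 8 * k" "\<And>i. i \<in> ?I \<Longrightarrow> \<bar>a i\<bar> \<le> int y" "\<And>i. i \<in> ?I \<Longrightarrow> \<bar>b i\<bar> \<le> int y"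
    "\<And>i j. i \<in> ?I \<Longrightarrow> j \<in> ?I \<Longrightarrow> \<bar>a i * b j - a j * b i\<bar> \<le> int y"
    using exists_uniform_bound[of ?I "8 * k" a b] by blast
  have ypos: "y > 0" using y(1) k by simp
  have not_dvd: "\<not> int p dvd z" if "p > y" "z \<noteq> 0" "\<bar>z\<bar> \<le> int y" for p z
    using that zdvd_imp_le[of "int p" "\<bar>z\<bar>"] by auto
  define W where "W = mertens_prod y"
  have W: "W > 0" unfolding W_def by (rule mertens_prod_pos)
  define \<delta> where "\<delta> = W / (8 * real y * C)"
  have "\<delta> > 0" using W C ypos by (simp add: \<delta>_def)
  then obtain P :: "nat \<Rightarrow> nat set" where
    P: "\<And>i. finite (P i)" "\<And>i p. p \<in> P i \<Longrightarrow> prime p \<and> p > y"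
    and disj: "\<And>i j. i \<noteq> j \<Longrightarrow> P i \<inter> P j = {}"
    and decay: "\<And>i. (\<Prod>p\<in>P (Suc i). 1 - 1 / real p) < \<delta> * (\<Prod>p\<in>P i. 1 - 1 / real p)"
    using exists_prime_blocks[of \<delta> y] by metis
  define w where "w i = (\<Prod>p\<in>P i. 1 - 1 / real p)" for i
  have w: "w i > 0" for i
    unfolding w_def using P prime_factor_bounds by (intro prod_pos) blast
  define U where "U = (\<Union>i\<in>?I. P i)"
  have finU: "finite U" unfolding U_def using P by auto
  define R where "R = \<Prod>U"
  have Rpos: "R > 0" unfolding R_def using P(2) prime_gt_0_nat
    by (intro prod_pos) (auto simp: U_def)
  \<comment> \<open>The index of the unique block containing \<open>p\<close>, for \<open>p\<close> in \<open>U\<close>\<close>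
  define idx where "idx p = (SOME i. i \<in> ?I \<and> p \<in> P i)" for p
  have idx: "idx p = i" if "i \<in> ?I" "p \<in> P i" for i p
    unfolding idx_def using that disj by (intro some_equality) auto
  have not_dvd_a: "\<not> int p dvd a i" if "p > y" "i \<in> ?I" for p i
    using that not_dvd[of p "a i"] y(2)[of i] a[of i] by auto
  have "\<exists>r::nat. \<forall>p\<in>U. int p dvd a (idx p) * int r + b (idx p)"
    using finU
  proof (rule exists_simultaneous_root_mod_primes)
    fix p assume "p \<in> U"
    then obtain i where "i \<in> ?I" "p \<in> P i" by (auto simp: U_def)
    then show "prime p \<and> \<not> int p dvd a (idx p)"
      using P(2) not_dvd_a idx by auto
  qed
  then obtain r :: nat where r_idx: "\<And>p. p \<in> U \<Longrightarrow> int p dvd a (idx p) * int r + b (idx p)" by blast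
  have r: "int p dvd a i * int r + b i" if "i \<in> ?I" "p \<in> P i" for i p
    using r_idx[of p] that unfolding idx[OF that] U_def by blast
  have p_dvd_R: "p dvd R" if "i \<in> ?I" "p \<in> P i" for i p
    unfolding R_def using that finU by (intro dvd_prodI) (auto simp: U_def)
  \<comment> \<open>The coefficients of the forms in the variable \<open>t\<close>, where \<open>n = r + R t\<close>\<close>
  define \<alpha> \<beta> where "\<alpha> i = a i * int R" and "\<beta> i = a i * int r + b i" for i
  have \<alpha>: "\<alpha> i > 0" if "i \<in> ?I" for i using a[OF that] Rpos by (simp add: \<alpha>_def)
  define Bad where "Bad i T = {t. t < T \<and> \<alpha> i * int t + \<beta> i > 0 \<and>
      large_prime_sum y (\<alpha> i) (\<alpha> i * int t + \<beta> i) > 1/2}" for i T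
  \<comment> \<open>From \<open>t0\<close> on, \<open>n > 2 y \<ge> 2 \<bar>b\<^sub>i\<bar>\<close>, so that \<open>m\<^sub>i \<ge> n / 2\<close>.\<close>
  define t0 where "t0 = 2 * y + 1"

  have good: "r + R * t \<in> ?S" if t: "t \<ge> t0" "t < T" "\<And>i. i \<in> ?I \<Longrightarrow> t \<notin> Bad i T" for t T
  proof -
    define n where "n = r + R * t"
    define m where "m i = a i * int n + b i" for i
    have m_eq: "m i = \<alpha> i * int t + \<beta> i" for i
      by (simp add: m_def n_def \<alpha>_def \<beta>_def algebra_simps)
    have "t \<le> R * t" using Rpos by simp
    then have n: "n \<ge> 2 * y + 1" using t(1) unfolding n_def t0_def by linarith
    have m_lower: "2 * m i \<ge> int n" if i: "i \<in> ?I" for i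
    proof -
      have "int n \<le> a i * int n"
        using a[OF i] mult_right_mono[of 1 "a i" "int n"] by simp
      moreover have "2 * int y + 1 \<le> int n" using n by linarith
      moreover have "- int y \<le> b i" using y(3)[OF i] by linarith
      ultimately show ?thesis unfolding m_def distrib_left by linarith
    qed
    have m_upper: "m i \<le> 2 * int y * int n" if i: "i \<in> ?I" for i
    proof -
      have "a i * int n \<le> int y * int n" using y(2)[OF i] by (intro mult_right_mono) auto
      moreover have "int y * 1 \<le> int y * int n" using n by (intro mult_left_mono) auto
      ultimately show ?thesis using y(3)[OF i] unfolding m_def by linarith
    qed
    have m_pos: "m i > 0" if i: "i \<in> ?I" for i using m_lower[OF i] n by linarith
    have P_dvd: "int p dvd m i" if "i \<in> ?I" "p \<in> P i" for i p
    proof -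
      have "int p dvd \<alpha> i" using p_dvd_R[OF that] by (simp add: \<alpha>_def)
      then show ?thesis unfolding m_eq \<beta>_def by (intro dvd_add dvd_mult2 r[OF that])
    qed
    have nat_dvd: "p dvd nat (m i) \<longleftrightarrow> int p dvd m i" if "i \<in> ?I" for i p
      using dvd_nat_abs_iff[of p "m i"] m_pos[OF that] by simp
    have upper: "real (totient (nat (m i))) \<le> real_of_int (m i) * w i" if i: "i \<in> ?I" for i
    proof -
      have "P i \<subseteq> prime_factors (nat (m i))"
        using P(2) P_dvd[OF i] nat_dvd[OF i] m_pos[OF i] by (auto simp: in_prime_factors_iff)
      from totient_le_prod[OF this] show ?thesis using m_pos[OF i] by (simp add: w_def)
    qed
    have lower: "real_of_int (m i) * (W * w i / 2) \<le> real (totient (nat (m i)))" if i: "i \<in> ?I" for i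
    proof -
      have "real (nat (m i)) * (mertens_prod y * (\<Prod>p\<in>P i. 1 - 1 / real p) / 2) \<le> real (totient (nat (m i)))"
      proof (rule totient_ge_prod)
        show "large_prime_sum y (\<alpha> i) (m i) \<le> 1/2"
          using t(2) t(3)[OF i] m_pos[OF i] unfolding Bad_def m_eq by auto
      next
        fix p assume p: "p \<in> prime_factors (nat (m i))" "p > y" "int p dvd \<alpha> i"
        then have prime: "prime p" and pm: "int p dvd m i" using nat_dvd[OF i, of p] by auto
        \<comment> \<open>\<open>p\<close> divides \<open>a\<^sub>i R\<close> but exceeds \<open>a\<^sub>i\<close>, so it belongs to some block \<open>P\<^sub>j\<close>; the determinant
            then forces \<open>i = j\<close>.\<close>
        have "int p dvd int R"
          using p(3) prime not_dvd_a[OF p(2) i] unfolding \<alpha>_def by (simp add: prime_dvd_mult_iff)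
        then have "p dvd \<Prod>U" unfolding R_def by (simp only: of_nat_dvd_iff)
        then obtain q where q: "q \<in> U" "p dvd q" using prime finU by (auto simp: prime_dvd_prod_iff)
        then obtain j where j: "j \<in> ?I" "q \<in> P j" by (auto simp: U_def)
        then have "p = q" using P(2)[of q j] prime q(2) primes_dvd_imp_eq by blast
        then have pj: "p \<in> P j" using j by simp
        have "i = j"
        proof (rule ccontr)
          assume "i \<noteq> j"
          then have nz: "a i * b j - a j * b i \<noteq> 0" using ab[OF i j(1)] by simp
          have "int p dvd a i * m j - a j * m i"
            using pm P_dvd[OF j(1) pj] by (intro dvd_diff dvd_mult)
          also have "a i * m j - a j * m i = a i * b j - a j * b i"
            by (simp add: m_def algebra_simps)
          finally show False using not_dvd[OF p(2) nz y(4)[OF i j(1)]] by simp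
        qed
        then show "p \<in> P i" using pj by simp
      qed (use P in auto)
      then show ?thesis using m_pos[OF i] by (simp add: W_def w_def)
    qed
    have "real (totient (nat (m i))) / real (totient (nat (m (i + 1)))) > C" if "i \<in> {1..<k}" for i
    proof -
      have i: "i \<in> ?I" "i + 1 \<in> ?I" using that by auto
      have "C * real (totient (nat (m (i + 1)))) \<le> C * (real_of_int (m (i + 1)) * w (i + 1))"
        using upper[OF i(2)] C by (intro mult_left_mono) auto
      also have "\<dots> < C * (real_of_int (m (i + 1)) * (\<delta> * w i))"
        using decay[of i] C m_pos[OF i(2)] unfolding w_def by (intro mult_strict_left_mono) auto
      also have "\<dots> \<le> C * (real_of_int (2 * int y * int n) * (\<delta> * w i))"
        using m_upper[OF i(2)] C \<open>\<delta> > 0\<close> w[of i]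
        by (intro mult_left_mono mult_right_mono) (simp_all only: of_int_le_iff, auto)
      also have "\<dots> = real n / 2 * (W * w i / 2)"
        unfolding \<delta>_def using C ypos by (simp add: field_simps)
      also have "\<dots> \<le> real_of_int (m i) * (W * w i / 2)"
        using m_lower[OF i(1)] W w[of i] by (intro mult_right_mono) auto
      also have "\<dots> \<le> real (totient (nat (m i)))" by (rule lower[OF i(1)])
      finally show ?thesis using m_pos[OF i(2)] by (simp add: pos_less_divide_eq)
    qed
    then show ?thesis using m_pos n unfolding n_def[symmetric] m_def by auto
  qed

  have "eventually (\<lambda>T. \<forall>i\<in>?I. real (card (Bad i T)) \<le> 4 * real T / real y) sequentially"
    unfolding Bad_def using \<alpha> ypos
    by (intro eventually_ball_finite ballI eventually_few_large_prime_sums) auto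
  then have "eventually (\<lambda>T. 1/4 * real T \<le> real (card {t. t < T \<and> r + R * t \<in> ?S})) sequentially"
    using eventually_ge_at_top[of "4 * t0"]
  proof eventually_elim
    case (elim T)
    \<comment> \<open>Out of \<open>T\<close> values at most \<open>T / 4\<close> are below \<open>t0\<close>, and at most \<open>k (4 T / y) \<le> T / 2\<close> are bad.\<close>
    let ?G = "{t. t < T \<and> r + R * t \<in> ?S}"
    have "{..<T} \<subseteq> ?G \<union> ({..<t0} \<union> (\<Union>i\<in>?I. Bad i T))"
      using good[of _ T] by (auto simp: not_less)
    then have "card {..<T} \<le> card (?G \<union> ({..<t0} \<union> (\<Union>i\<in>?I. Bad i T)))"
      by (intro card_mono) (auto simp: Bad_def)
    also have "\<dots> \<le> card ?G + (t0 + (\<Sum>i\<in>?I. card (Bad i T)))"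
      using card_Un_le[of ?G "{..<t0} \<union> (\<Union>i\<in>?I. Bad i T)"]
        card_Un_le[of "{..<t0}" "\<Union>i\<in>?I. Bad i T"] card_UN_le[of ?I "\<lambda>i. Bad i T"]
      by simp
    finally have "real T \<le> real (card ?G) + real t0 + (\<Sum>i\<in>?I. real (card (Bad i T)))"
      by (simp flip: of_nat_add of_nat_sum)
    moreover have "(\<Sum>i\<in>?I. real (card (Bad i T))) \<le> real k * (4 * real T / real y)"
      using sum_bounded_above[of ?I "\<lambda>i. real (card (Bad i T))" "4 * real T / real y"] elim(1) by simp
    moreover have "real k * (4 * real T / real y) \<le> real T / 2"
    proof -
      have "real (8 * k) * real T \<le> real y * real T"
        using y(1) by (intro mult_right_mono) auto
      then show ?thesis using ypos by (simp add: field_simps)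
    qed
    moreover have "real T \<ge> 4 * real t0" using elim(2) by linarith
    ultimately show ?case by linarith
  qed
  then show ?thesis by (rule lower_density_pos_if_progression[OF Rpos, rotated]) simp
qed

theorem theorem1:
  fixes k :: nat and a b :: "nat \<Rightarrow> int"
  assumes "k \<ge> 2"
    and "\<And>i. 1 \<le> i \<Longrightarrow> i \<le> k \<Longrightarrow> a i > 0"
    and "\<And>i j. 1 \<le> i \<Longrightarrow> i < j \<Longrightarrow> j \<le> k \<Longrightarrow> a i * b j \<noteq> a j * b i"
  shows "(\<forall>C::real. C > 0 \<longrightarrow>
            lower_density {n::nat. n > 0 \<and> (\<forall>i\<in>{1..k}. a i * int n + b i > 0) \<and>
              (\<forall>i\<in>{1..<k}.
                 real (totient (nat (a i * int n + b i)))
                   / real (totient (nat (a (i + 1) * int n + b (i + 1)))) > C)} > 0)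
       \<and> lower_density {n::nat. n > 0 \<and> (\<forall>i\<in>{1..k}. a i * int n + b i > 0) \<and>
              (\<forall>i\<in>{1..<k}.
                 totient (nat (a i * int n + b i))
                   > totient (nat (a (i + 1) * int n + b (i + 1))))} > 0"
    (is "(\<forall>C. C > 0 \<longrightarrow> lower_density (?S C) > 0) \<and> lower_density ?D > 0")
proof -
  have ab: "a i * b j \<noteq> a j * b i" if "i \<in> {1..k}" "j \<in> {1..k}" "i \<noteq> j" for i j
    using assms(3)[of i j] assms(3)[of j i] that by (cases "i < j") auto
  have ratios: "lower_density (?S C) > 0" if "C > 0" for C
    using assms ab that by (intro totient_ratios_lower_density_pos) auto
  have "?S 1 \<subseteq> ?D"
  proof safe
    fix n i
    assume i: "i \<in> {1..<k}" and pos: "\<forall>i\<in>{1..k}. 0 < a i * int n + b i"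
      and ratio: "\<forall>i\<in>{1..<k}. 1 < real (totient (nat (a i * int n + b i)))
                   / real (totient (nat (a (i + 1) * int n + b (i + 1))))"
    have "0 < a (i + 1) * int n + b (i + 1)" using pos i by auto
    then have "0 < real (totient (nat (a (i + 1) * int n + b (i + 1))))" by simp
    then show "totient (nat (a (i + 1) * int n + b (i + 1))) < totient (nat (a i * int n + b i))"
      using ratio[rule_format, OF i] by (simp only: less_divide_eq_1_pos of_nat_less_iff)
  qed
  then have "lower_density (?S 1) \<le> lower_density ?D" by (rule lower_density_mono)
  then have "lower_density ?D > 0" using ratios[of 1] by (rule less_le_trans[rotated]) simp
  then show ?thesis using ratios by blast
qed

end
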